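(* Let $\omega:[0,+\infty)\to[0,+\infty)$ be a weight function such that $\log(t)=o(\omega(t))$ as $t\to+\infty$ and $\varphi_\omega:t\mapsto\omega(e^t)$ is convex on $\mathbb{R}$. Let $\Omega=\{W^{(\lambda)}:\lambda>0\}$ be the matrix associated with $\omega$ and $w^{(\lambda)}_j:=W^{(\lambda)}_j/j!$. Then the following three conditions are equivalent: (R) $\forall\,\lambda>0\ \exists\,\kappa>0\ \exists\,C,h>0\ \forall\,j\in\mathbb{N}:\ (w^{(\lambda)}_j)^2\le Ch^jw^{(\kappa)}_j$; (B) $\forall\,\lambda>0\ \exists\,\kappa>0\ \exists\,C,h>0\ \forall\,j\in\mathbb{N}:\ (w^{(\kappa)}_j)^2\le Ch^jw^{(\lambda)}_j$; (M) $\exists\,H>0\ \exists\,C>0\ \forall\,t\ge0:\ (\omega^\iota)_\star(t^2)\le C\omega(Ht)+C$.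
   Context: $\mathbb{N}=\{0,1,2,\dots\}$. A weight function is a continuous, increasing (i.e. nondecreasing) function $\omega:[0,+\infty)\to[0,+\infty)$ with $\omega(t)=0$ for $t\in[0,1]$ and $\lim_{t\to+\infty}\omega(t)=+\infty$. Associated matrix: $\varphi^*_\omega(x):=\sup\{xy-\varphi_\omega(y):y\ge0\}$ for $x\ge0$, and $W^{(\lambda)}_j:=\exp\big(\frac1\lambda\varphi^*_\omega(\lambda j)\big)$ for $j\in\mathbb{N}$, $\lambda>0$. Lower Legendre conjugate: $\omega^\iota(s):=\omega(1/s)$ for $s>0$, and $(\omega^\iota)_\star(t):=\inf_{s>0}\{\omega(1/s)+ts\}$ for $t\ge0$. *)

theory Defs
  imports "HOL-Analysis.Analysis" "HOL-Library.Landau_Symbols"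
begin

text \<open>Functions on \<open>[0,\<infinity>)\<close> are represented by total functions on the reals;
  their values at negative arguments are unconstrained and never used.\<close>

definition weight_function :: "(real \<Rightarrow> real) \<Rightarrow> bool" where
  "weight_function \<omega> \<longleftrightarrow>
     (\<forall>t\<ge>0. \<omega> t \<ge> 0) \<and> continuous_on {0..} \<omega> \<and> mono_on {0..} \<omega> \<and>
     (\<forall>t\<in>{0..1}. \<omega> t = 0) \<and> filterlim \<omega> at_top at_top"

definition phi :: "(real \<Rightarrow> real) \<Rightarrow> real \<Rightarrow> real" where
  "phi \<omega> t = \<omega> (exp t)"

text \<open>The supremum is taken in the reals. It is finite for all \<open>x \<ge> 0\<close> as soon as
  \<open>log t = o(\<omega>(t))\<close>, see \<open>bdd_above_phi_star\<close> below.\<close>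

definition phi_star :: "(real \<Rightarrow> real) \<Rightarrow> real \<Rightarrow> real" where
  "phi_star \<omega> x = (SUP y\<in>{0..}. x * y - phi \<omega> y)"

definition W :: "(real \<Rightarrow> real) \<Rightarrow> real \<Rightarrow> nat \<Rightarrow> real" where
  "W \<omega> l j = exp (1 / l * phi_star \<omega> (l * real j))"

definition w :: "(real \<Rightarrow> real) \<Rightarrow> real \<Rightarrow> nat \<Rightarrow> real" where
  "w \<omega> l j = W \<omega> l j / fact j"

text \<open>\<open>\<omega>\<^sup>\<iota>\<close>, relevant for arguments \<open>s > 0\<close> only.\<close>

definition iota :: "(real \<Rightarrow> real) \<Rightarrow> real \<Rightarrow> real" where
  "iota \<omega> s = \<omega> (1 / s)"

definition lower_conj :: "(real \<Rightarrow> real) \<Rightarrow> real \<Rightarrow> real" where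
  "lower_conj g t = (INF s\<in>{0<..}. g s + t * s)"

lemma bdd_above_phi_star:
  assumes "weight_function \<omega>" and o: "(\<lambda>t. ln t) \<in> o(\<omega>)" and x: "x \<ge> 0"
  shows "bdd_above ((\<lambda>y. x * y - phi \<omega> y) ` {0..})"
proof -
  have nn: "\<omega> t \<ge> 0" if "t \<ge> 0" for t
    using assms(1) that by (auto simp: weight_function_def)
  have "\<forall>\<^sub>F t in at_top. norm (ln t) \<le> 1 / (x + 1) * norm (\<omega> t)"
    using landau_o.smallD[OF o, of "1 / (x + 1)"] x by auto
  then obtain T where T: "\<And>t. t \<ge> T \<Longrightarrow> \<bar>ln t\<bar> \<le> 1 / (x + 1) * \<bar>\<omega> t\<bar>"
    by (auto simp: eventually_at_top_linorder)
  define Y where "Y = max 0 (ln (max 1 T))"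
  have "x * y - phi \<omega> y \<le> x * Y" if y: "y \<ge> 0" for y
  proof (cases "exp y \<ge> T")
    case True
    have "y \<le> 1 / (x + 1) * \<omega> (exp y)" using T[OF True] y nn[of "exp y"] by simp
    then have "(x + 1) * y \<le> \<omega> (exp y)" using x by (simp add: field_simps)
    then have "x * y - phi \<omega> y \<le> 0" using y by (simp add: phi_def algebra_simps)
    also have "0 \<le> x * Y" using x by (simp add: Y_def)
    finally show ?thesis .
  next
    case False
    then have "exp y \<le> max 1 T" by simp
    then have "y \<le> ln (max 1 T)" by (simp add: ln_ge_iff)
    then have "x * y \<le> x * Y" using x by (intro mult_left_mono) (auto simp: Y_def)
    then show ?thesis using nn[of "exp y"] by (simp add: phi_def)
  qed
  then show ?thesis by (intro bdd_aboveI[of _ "x * Y"]) auto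
qed

lemma bdd_below_lower_conj:
  assumes "weight_function \<omega>" and "t \<ge> 0"
  shows "bdd_below ((\<lambda>s. iota \<omega> s + t * s) ` {0<..})"
  using assms by (intro bdd_belowI[of _ 0]) (auto simp: weight_function_def iota_def)

end

theory Submission
  imports Defs
begin

text \<open>After taking logarithms, \<open>(w\<^sup>(\<^sup>l\<^sup>)\<^sub>j)\<^sup>2 \<le> C h\<^sup>j w\<^sup>(\<^sup>k\<^sup>)\<^sub>j\<close> compares \<open>2/l \<phi>\<^sup>*(l j)\<close> with
  \<open>1/k \<phi>\<^sup>*(k j) + ln j!\<close>. The right-hand side dominates \<open>j ln (\<tau>/k) - (\<omega>(u) + \<tau>/u)/k\<close> for all
  \<open>u, \<tau> > 0\<close> (Young's inequality for \<open>\<phi>\<close> and \<open>v\<^sup>j/j! \<le> e\<^sup>v\<close>), so (M) yields the comparison for all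
  \<open>k\<close> with \<open>l\<close> a fixed multiple of \<open>k\<close>, which gives (R) and (B) at once.
  Conversely one pair \<open>l, k\<close> suffices for (M): at a minimum \<open>u = e\<^sup>y\<close> of \<open>\<omega>(u)/(2k) + s/u\<close> the number
  \<open>2k s/u\<close> is a subgradient of \<open>\<phi>\<close> at \<open>y\<close>, so Young's inequality is an equality there, and
  inserting \<open>j \<approx> s/u\<close> bounds the minimum by a multiple of \<open>\<omega>(t)\<close>, where \<open>s\<close> is a
  multiple of \<open>t\<^sup>2\<close>.\<close>

section \<open>Young's inequality for \<open>phi\<close> and \<open>phi_star\<close>\<close>

lemma weight_function_nonneg: "weight_function \<omega> \<Longrightarrow> t \<ge> 0 \<Longrightarrow> \<omega> t \<ge> 0"
  by (simp add: weight_function_def)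

lemma phi_nonneg: "weight_function \<omega> \<Longrightarrow> phi \<omega> y \<ge> 0"
  by (simp add: weight_function_nonneg phi_def)

lemma phi_zero: "weight_function \<omega> \<Longrightarrow> phi \<omega> 0 = 0"
  by (simp add: weight_function_def phi_def)

lemma phi_star_le:
  assumes "\<And>y. y \<ge> 0 \<Longrightarrow> x * y - phi \<omega> y \<le> a"
  shows "phi_star \<omega> x \<le> a"
  unfolding phi_star_def using assms by (intro cSUP_least) auto

text \<open>Young's inequality also holds for \<open>y < 0\<close>, outside the range of the
  supremum: there \<open>x * y \<le> 0\<close>, while \<open>y = 0\<close> gives
  \<open>phi_star \<omega> x \<ge> 0\<close>. This covers \<open>y = ln (1 / s)\<close> with
  \<open>s > 1\<close>.\<close>

lemma phi_star_ge:
  assumes wt: "weight_function \<omega>" and o: "(\<lambda>t. ln t) \<in> o(\<omega>)" and x: "x \<ge> 0"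
  shows "x * y - phi \<omega> y \<le> phi_star \<omega> x"
proof -
  have *: "x * z - phi \<omega> z \<le> phi_star \<omega> x" if "z \<ge> 0" for z
    unfolding phi_star_def
    using that by (intro cSUP_upper bdd_above_phi_star[OF wt o x]) auto
  show ?thesis
  proof (cases "y \<ge> 0")
    case False
    then have "x * y \<le> 0" using x by (simp add: mult_nonneg_nonpos)
    moreover have "0 \<le> phi_star \<omega> x" using *[of 0] phi_zero[OF wt] by simp
    ultimately show ?thesis using phi_nonneg[OF wt, of y] by linarith
  qed (rule *)
qed

text \<open>Makes rounding a real \<open>x\<close> up to an index cheap:
  \<open>k * (x + 1) * y - phi \<omega> y\<close> is the mean of the expressions with slopes
  \<open>2 * k * x\<close> and \<open>2 * k\<close>. The price is doubling \<open>k\<close>.\<close>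

lemma phi_star_add_one:
  assumes wt: "weight_function \<omega>" and o: "(\<lambda>t. ln t) \<in> o(\<omega>)"
    and k: "k > 0" and x: "x \<ge> 0" and z: "z \<le> x + 1"
  shows "phi_star \<omega> (k * z) \<le> (phi_star \<omega> (2 * k * x) + phi_star \<omega> (2 * k)) / 2"
proof (rule phi_star_le)
  fix y :: real assume y: "y \<ge> 0"
  have "k * z * y \<le> k * (x + 1) * y"
    using k y z by (intro mult_right_mono mult_left_mono) auto
  moreover have "2 * k * x * y - phi \<omega> y \<le> phi_star \<omega> (2 * k * x)"
    "2 * k * y - phi \<omega> y \<le> phi_star \<omega> (2 * k)"
    using k x by (intro phi_star_ge[OF wt o]; simp)+
  ultimately show "k * z * y - phi \<omega> y \<le> (phi_star \<omega> (2 * k * x) + phi_star \<omega> (2 * k)) / 2"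
    by (simp add: algebra_simps)
qed

section \<open>Logarithmic form of the matrix inequality, and factorial estimates\<close>

lemma w_square_le_iff:
  assumes "C > 0" "h > 0"
  shows "(w \<omega> l j)\<^sup>2 \<le> C * h ^ j * w \<omega> k j \<longleftrightarrow>
    2 / l * phi_star \<omega> (l * j) \<le> ln C + j * ln h + 1 / k * phi_star \<omega> (k * j) + ln (fact j)"
proof -
  have pos: "w \<omega> l j > 0" "w \<omega> k j > 0" by (simp_all add: w_def W_def)
  have ln_w: "ln (w \<omega> m j) = 1 / m * phi_star \<omega> (m * j) - ln (fact j)" for m
    by (simp add: w_def W_def ln_div)
  have "(w \<omega> l j)\<^sup>2 \<le> C * h ^ j * w \<omega> k j \<longleftrightarrow>
      ln ((w \<omega> l j)\<^sup>2) \<le> ln (C * h ^ j * w \<omega> k j)"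
    using assms pos by (subst ln_le_cancel_iff) auto
  also have "ln ((w \<omega> l j)\<^sup>2) = 2 * ln (w \<omega> l j)"
    using pos by (simp add: ln_realpow)
  also have "ln (C * h ^ j * w \<omega> k j) = ln C + j * ln h + ln (w \<omega> k j)"
    using assms pos by (simp add: ln_mult ln_realpow)
  finally show ?thesis by (simp add: ln_w algebra_simps)
qed

lemma mult_ln_le_add_ln_fact:
  fixes v :: real
  assumes "v > 0"
  shows "n * ln v \<le> v + ln (fact n)"
proof -
  have "(\<Sum>i\<in>{n}. v ^ i / fact i) \<le> exp v"
    using sum_le_suminf[OF summable_exp_generic[of v], of "{n}"] assms
    by (simp add: exp_def divide_inverse_commute)
  then have "ln (v ^ n / fact n) \<le> v"
    using assms ln_mono[of "v ^ n / fact n" "exp v"] by simp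
  then show ?thesis using assms by (simp add: ln_div ln_realpow)
qed

lemma ln_fact_le: "ln (fact n) \<le> n * ln (real n)"
proof (cases "n = 0")
  case False
  have "fact n \<le> real n ^ n"
    using fact_le_power[of n, where 'a = real] by simp
  then have "ln (fact n) \<le> ln (real n ^ n)" by (subst ln_le_cancel_iff) (use False in auto)
  then show ?thesis using False by (simp add: ln_realpow)
qed simp

text \<open>Rounding cost for \<open>x * ln x\<close>, from
  \<open>ln (1 + 1 / x) \<le> 1 / x\<close> and \<open>ln (1 + x) \<le> x\<close>.\<close>

lemma add_one_mult_ln_le:
  fixes x :: real
  assumes "x > 0"
  shows "(x + 1) * ln (x + 1) \<le> x * ln x + x + 1"
proof -
  have "ln (x + 1) - ln x = ln (1 + 1 / x)"
    using ln_div[of "x + 1" x] assms by (simp add: add_divide_distrib)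
  also have "\<dots> \<le> 1 / x" using assms by (intro ln_add_one_self_le_self) auto
  finally have "x * (ln (x + 1) - ln x) \<le> x * (1 / x)"
    using assms by (intro mult_left_mono) auto
  moreover have "ln (x + 1) \<le> x" using ln_add_one_self_le_self[of x] assms by (simp add: add.commute)
  ultimately show ?thesis using assms by (simp add: algebra_simps)
qed

section \<open>From (M) to the matrix inequality\<close>

lemma w_square_le_if_lower_conj_le:
  assumes wt: "weight_function \<omega>" and o: "(\<lambda>t. ln t) \<in> o(\<omega>)"
    and H: "H > 0" and C: "C > 0" and k: "k > 0"
    and M: "\<And>t. t \<ge> 0 \<Longrightarrow> lower_conj (iota \<omega>) (t\<^sup>2) \<le> C * \<omega> (H * t) + C"
  shows "(w \<omega> (2 * k / C) j)\<^sup>2 \<le> exp (C / k) * (H\<^sup>2 * k) ^ j * w \<omega> k j"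
proof -
  define K where "K = 1 / k * phi_star \<omega> (k * j) + ln (fact j)"
  have lower: "k * (j * ln (\<tau> / k) - K) \<le> lower_conj (iota \<omega>) \<tau>" if \<tau>: "\<tau> > 0" for \<tau>
    unfolding lower_conj_def
  proof (intro cINF_greatest)
    fix s :: real assume "s \<in> {0<..}"
    then have s: "s > 0" by simp
    \<comment> \<open>Young's inequality at \<open>ln (1 / s)\<close> is paired with the factorial
      bound at \<open>\<tau> * s / k\<close>; in the sum of the two logarithms \<open>s\<close>
      cancels.\<close>
    have "k * j * ln (1 / s) - phi \<omega> (ln (1 / s)) \<le> phi_star \<omega> (k * j)"
      using k by (intro phi_star_ge[OF wt o]) simp
    then have "k * j * ln (1 / s) - \<omega> (1 / s) \<le> phi_star \<omega> (k * j)"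
      using s by (simp add: phi_def)
    moreover have "k * (j * ln (\<tau> * s / k)) \<le> k * (\<tau> * s / k + ln (fact j))"
      using \<tau> s k by (intro mult_left_mono mult_ln_le_add_ln_fact) auto
    ultimately show "k * (j * ln (\<tau> / k) - K) \<le> iota \<omega> s + \<tau> * s"
      using \<tau> s k by (simp add: K_def iota_def ln_mult ln_div algebra_simps)
  qed simp
  have "phi_star \<omega> (2 * k / C * j) \<le> 1 + k / C * (j * ln (H\<^sup>2 * k) + K)"
  proof (rule phi_star_le)
    fix y :: real
    \<comment> \<open>The choice \<open>t = exp y / H\<close> turns \<open>\<omega> (H * t)\<close>
      into \<open>phi \<omega> y\<close>. The square in (M) yields \<open>2 * y\<close>, hence the
      slope \<open>2 * k / C * j\<close>.\<close>
    have "k * (j * ln ((exp y / H)\<^sup>2 / k) - K) \<le> C * phi \<omega> y + C"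
      using lower[of "(exp y / H)\<^sup>2"] M[of "exp y / H"] H by (simp add: phi_def)
    moreover have "ln ((exp y / H)\<^sup>2 / k) = 2 * y - ln (H\<^sup>2 * k)"
      using H k by (simp add: ln_div ln_mult ln_realpow)
    ultimately have "k * (j * (2 * y - ln (H\<^sup>2 * k)) - K) / C \<le> phi \<omega> y + 1"
      using C by (simp add: divide_le_eq algebra_simps)
    moreover have "k * (j * (2 * y - ln (H\<^sup>2 * k)) - K) / C =
        2 * k / C * j * y - k / C * (j * ln (H\<^sup>2 * k) + K)"
      using C by (simp add: field_simps)
    ultimately show "2 * k / C * j * y - phi \<omega> y \<le> 1 + k / C * (j * ln (H\<^sup>2 * k) + K)"
      by linarith
  qed
  then have "C / k * phi_star \<omega> (2 * k / C * j) \<le> C / k * (1 + k / C * (j * ln (H\<^sup>2 * k) + K))"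
    using C k by (intro mult_left_mono) auto
  also have "\<dots> = C / k + j * ln (H\<^sup>2 * k) + K" using C k by (simp add: field_simps)
  finally show ?thesis
    using C k H by (subst w_square_le_iff) (auto simp: K_def)
qed

section \<open>From one matrix inequality to (M)\<close>

lemma phi_plus_exp_attains_min:
  assumes wt: "weight_function \<omega>" and k: "k > 0" and s: "s > 0"
  obtains y where "\<And>z. phi \<omega> y + k * s * exp (- y) \<le> phi \<omega> z + k * s * exp (- z)"
proof -
  define g where "g z = phi \<omega> z + k * s * exp (- z)" for z
  have ks: "k * s > 0" using k s by simp
  have cont: "continuous_on {0..} \<omega>" and lim: "filterlim \<omega> at_top at_top"
    using wt by (auto simp: weight_function_def)
  have "continuous_on UNIV (\<lambda>z. \<omega> (exp z))"
    by (rule continuous_on_compose2[OF cont]) (auto intro!: continuous_intros)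
  then have g_cont: "continuous_on UNIV g"
    unfolding g_def phi_def by (intro continuous_intros)
  have "filterlim (\<lambda>z. \<omega> (exp z)) at_top at_top"
    by (rule filterlim_compose[OF lim exp_at_top])
  then have "\<forall>\<^sub>F z in at_top. phi \<omega> z \<ge> k * s"
    by (simp add: filterlim_at_top phi_def)
  then obtain b0 where b0: "\<And>z. z \<ge> b0 \<Longrightarrow> phi \<omega> z \<ge> k * s"
    by (auto simp: eventually_at_top_linorder)
  \<comment> \<open>Outside \<open>{0..b}\<close> the value of \<open>g\<close> is at least
    \<open>g 0 = k * s\<close>: on the left by the exponential term, on the right by
    \<open>phi\<close>. So a minimum on this interval is global.\<close>
  define b where "b = max 0 b0"
  have "\<exists>y\<in>{0..b}. \<forall>z\<in>{0..b}. g y \<le> g z"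
    by (intro continuous_attains_inf continuous_on_subset[OF g_cont]) (auto simp: b_def)
  then obtain y where y: "\<And>z. z \<in> {0..b} \<Longrightarrow> g y \<le> g z" by blast
  have g0: "g y \<le> k * s"
    using y[of 0] phi_zero[OF wt] by (simp add: g_def b_def)
  have "g y \<le> g z" for z
  proof -
    consider "z < 0" | "z \<in> {0..b}" | "z > b" by fastforce
    then show ?thesis
    proof cases
      case 1
      then have "k * s * 1 \<le> k * s * exp (- z)" using ks by (intro mult_left_mono) auto
      then show ?thesis using g0 phi_nonneg[OF wt, of z] by (simp add: g_def)
    next
      case 3
      then have "phi \<omega> z \<ge> k * s" by (intro b0) (simp add: b_def)
      moreover have "k * s * exp (- z) \<ge> 0" using ks by simp
      ultimately show ?thesis using g0 unfolding g_def by linarith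
    qed (rule y)
  qed
  then show thesis unfolding g_def by (rule that)
qed

text \<open>At a minimum, a subgradient of \<open>f\<close> balances the slope of the exponential.
  As \<open>f\<close> need not be differentiable, convexity and minimality are compared on the
  segment from \<open>y\<close> to \<open>z\<close>, and the step \<open>\<theta>\<close> tends to
  0.\<close>

lemma convex_plus_exp_min_subgradient:
  fixes f :: "real \<Rightarrow> real"
  assumes conv: "convex_on UNIV f" and a: "a > 0"
    and min: "\<And>z. f y + a * exp (- y) \<le> f z + a * exp (- z)"
  shows "f y + a * exp (- y) * (z - y) \<le> f z"
proof -
  define d where "d = z - y"
  define x where "x = a * exp (- y)"
  have "((\<lambda>\<theta>. x * ((1 - exp (- (\<theta> * d))) / \<theta>)) \<longlongrightarrow> x * d) (at_right 0)"
  proof (rule tendsto_mult_left)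
    have "((\<lambda>\<theta>. 1 - exp (- (\<theta> * d))) has_real_derivative d) (at 0)"
      by (auto intro!: derivative_eq_intros)
    then have "((\<lambda>\<theta>. (1 - exp (- (\<theta> * d))) / \<theta>) \<longlongrightarrow> d) (at 0)"
      by (simp add: has_field_derivative_iff)
    then show "((\<lambda>\<theta>. (1 - exp (- (\<theta> * d))) / \<theta>) \<longlongrightarrow> d) (at_right 0)"
      by (rule filterlim_mono) (auto simp: at_le)
  qed
  moreover have "\<forall>\<^sub>F \<theta> in at_right 0. x * ((1 - exp (- (\<theta> * d))) / \<theta>) \<le> f z - f y"
    unfolding eventually_at_right_field
  proof (intro exI[of _ 1] conjI allI impI)
    fix \<theta> :: real assume \<theta>: "0 < \<theta>" "\<theta> < 1"
    have "f ((1 - \<theta>) *\<^sub>R y + \<theta> *\<^sub>R z) \<le> (1 - \<theta>) * f y + \<theta> * f z"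
      using \<theta> by (intro convex_onD[OF conv]) auto
    moreover have "(1 - \<theta>) *\<^sub>R y + \<theta> *\<^sub>R z = y + \<theta> * d" by (simp add: d_def algebra_simps)
    ultimately have "f (y + \<theta> * d) \<le> f y + \<theta> * (f z - f y)" by (simp add: algebra_simps)
    moreover have "f y + x \<le> f (y + \<theta> * d) + x * exp (- (\<theta> * d))"
      using min[of "y + \<theta> * d"] exp_add[of "- y" "- (\<theta> * d)"] by (simp add: x_def)
    ultimately have "x * (1 - exp (- (\<theta> * d))) \<le> \<theta> * (f z - f y)"
      by (simp add: algebra_simps)
    then show "x * ((1 - exp (- (\<theta> * d))) / \<theta>) \<le> f z - f y"
      using \<theta> by (simp add: field_simps)
  qed simp
  ultimately have "x * d \<le> f z - f y" by (rule tendsto_upperbound) simp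
  then show ?thesis by (simp add: x_def d_def)
qed

lemma lower_conj_le:
  assumes "weight_function \<omega>" "t \<ge> 0" "s > 0"
  shows "lower_conj (iota \<omega>) t \<le> \<omega> (1 / s) + t * s"
  using cINF_lower[OF bdd_below_lower_conj[OF assms(1,2)], of s] assms(3)
  by (simp add: lower_conj_def iota_def)

lemma lower_conj_le_if_w_square_le:
  assumes wt: "weight_function \<omega>" and o: "(\<lambda>t. ln t) \<in> o(\<omega>)"
    and conv: "convex_on UNIV (phi \<omega>)"
    and l: "l > 0" and k: "k > 0" and C: "C > 0" and h: "h > 0"
    and le: "\<And>j. (w \<omega> l j)\<^sup>2 \<le> C * h ^ j * w \<omega> k j"
  shows "\<exists>H>0. \<exists>C>0. \<forall>t\<ge>0. lower_conj (iota \<omega>) (t\<^sup>2) \<le> C * \<omega> (H * t) + C"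
proof -
  define b where "b = max 0 (ln h)"
  define A where "A = \<bar>ln C\<bar> + b + 1 + phi_star \<omega> (2 * k) / (2 * k)"
  \<comment> \<open>The factor \<open>exp (- 2 - b)\<close> makes \<open>ln x\<close> below contain
    \<open>- 2 - b\<close>, which absorbs the terms \<open>x * b\<close> and \<open>x\<close> and
    leaves a spare \<open>- x\<close>.\<close>
  define c where "c = 2 * k * exp (- 2 - b)"
  have "phi_star \<omega> (2 * k) / (2 * k) \<ge> 0"
    using phi_star_ge[OF wt o, of "2 * k" 0] k phi_zero[OF wt] by simp
  then have A: "A > 0" by (simp add: A_def b_def add_nonneg_pos add_pos_nonneg)
  have c: "c > 0" using k by (simp add: c_def)
  have main: "lower_conj (iota \<omega>) (c * t\<^sup>2) \<le> 2 * k * (2 / l * \<omega> t + A)" if t: "t \<ge> 1" for t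
  proof -
    define s where "s = t\<^sup>2 * exp (- 2 - b)"
    have s: "s > 0" using t by (simp add: s_def)
    obtain y where y: "\<And>z. phi \<omega> y + 2 * k * s * exp (- y) \<le> phi \<omega> z + 2 * k * s * exp (- z)"
      using phi_plus_exp_attains_min[OF wt _ s, of "2 * k"] k by auto
    define x where "x = s * exp (- y)"
    have x: "x > 0" using s by (simp add: x_def)
    have ln_x: "ln x = 2 * ln t - 2 - b - y"
      using t s by (simp add: x_def s_def ln_mult ln_realpow)
    \<comment> \<open>With Young's inequality this is an equality: the supremum is attained at the
      minimizer \<open>y\<close>. The weight \<open>2 * k\<close> matches the doubling in
      \<open>phi_star_add_one\<close>.\<close>
    have subgrad: "phi_star \<omega> (2 * k * x) \<le> 2 * k * x * y - phi \<omega> y"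
    proof (rule phi_star_le)
      fix z :: real
      have "phi \<omega> y + 2 * k * s * exp (- y) * (z - y) \<le> phi \<omega> z"
        using k s y by (intro convex_plus_exp_min_subgradient[OF conv]) auto
      then show "2 * k * x * z - phi \<omega> z \<le> 2 * k * x * y - phi \<omega> y"
        by (simp add: x_def algebra_simps)
    qed
    \<comment> \<open>Rounding up, not down, keeps \<open>x * ln t \<le> j * ln t\<close>, as
      \<open>t \<ge> 1\<close>.\<close>
    define j where "j = nat \<lceil>x\<rceil>"
    have j: "x \<le> real j" "real j \<le> x + 1" using x by (auto simp: j_def)
    have "2 / l * (l * j * ln t - phi \<omega> (ln t)) \<le> 2 / l * phi_star \<omega> (l * j)"
      using l by (intro mult_left_mono phi_star_ge[OF wt o]) auto
    also have "\<dots> \<le> ln C + j * ln h + 1 / k * phi_star \<omega> (k * j) + ln (fact j)"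
      using le[of j] by (simp only: w_square_le_iff[OF C h])
    also have "ln C \<le> \<bar>ln C\<bar>" by simp
    also have "j * ln h \<le> (x + 1) * b"
      using j x by (intro order.trans[OF mult_left_mono mult_right_mono]) (auto simp: b_def)
    also have "1 / k * phi_star \<omega> (k * j) \<le>
        1 / k * ((phi_star \<omega> (2 * k * x) + phi_star \<omega> (2 * k)) / 2)"
      using k j x by (intro mult_left_mono phi_star_add_one[OF wt o]) auto
    also have "\<dots> \<le> 1 / k * ((2 * k * x * y - phi \<omega> y + phi_star \<omega> (2 * k)) / 2)"
      using k subgrad by (intro mult_left_mono) auto
    also have "\<dots> = x * y - phi \<omega> y / (2 * k) + phi_star \<omega> (2 * k) / (2 * k)"
      using k by (simp add: field_simps)
    also have "ln (fact j) \<le> j * ln (real j)" by (rule ln_fact_le)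
    also have "\<dots> \<le> (x + 1) * ln (x + 1)"
      using j x by (intro mult_mono) auto
    also have "\<dots> \<le> x * ln x + x + 1" using x by (rule add_one_mult_ln_le)
    finally have "2 / l * (l * j * ln t - \<omega> t) \<le>
        \<bar>ln C\<bar> + (x + 1) * b + (x * y - phi \<omega> y / (2 * k) + phi_star \<omega> (2 * k) / (2 * k))
        + (x * ln x + x + 1)"
      using t by (simp add: phi_def)
    moreover have "2 / l * (l * j * ln t - \<omega> t) = 2 * (j * ln t) - 2 / l * \<omega> t"
      using l by (simp add: field_simps)
    moreover have "x * ln t \<le> j * ln t" using j t by (intro mult_right_mono) auto
    \<comment> \<open>Substituting \<open>ln_x\<close> cancels \<open>2 * x * ln t\<close>,
      \<open>x * y\<close> and \<open>x * b\<close>; \<open>A\<close> collects the remaining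
      constants.\<close>
    ultimately have "phi \<omega> y / (2 * k) + x \<le> 2 / l * \<omega> t + A"
      by (simp add: ln_x A_def algebra_simps)
    then have "2 * k * (phi \<omega> y / (2 * k) + x) \<le> 2 * k * (2 / l * \<omega> t + A)"
      using k by (intro mult_left_mono) auto
    moreover have "lower_conj (iota \<omega>) (c * t\<^sup>2) \<le> \<omega> (1 / exp (- y)) + c * t\<^sup>2 * exp (- y)"
      using c by (intro lower_conj_le[OF wt]) auto
    moreover have "\<omega> (1 / exp (- y)) = phi \<omega> y" by (simp add: phi_def exp_minus inverse_eq_divide)
    moreover have "c * t\<^sup>2 * exp (- y) = 2 * k * x" by (simp add: c_def x_def s_def)
    ultimately show ?thesis using k by (simp add: distrib_left)
  qed
  define D where "D = max c (max (2 * k * (2 / l)) (2 * k * A))"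
  have D: "D > 0" "D \<ge> c" "D \<ge> 2 * k * (2 / l)" "D \<ge> 2 * k * A"
    using c by (simp_all add: D_def less_max_iff_disj)
  have bound: "lower_conj (iota \<omega>) (t\<^sup>2) \<le> D * \<omega> (1 / sqrt c * t) + D" if t: "t \<ge> 0" for t
  proof (cases "t / sqrt c \<ge> 1")
    case True
    have "c * (t / sqrt c)\<^sup>2 = t\<^sup>2" using c by (simp add: power_divide)
    then have "lower_conj (iota \<omega>) (t\<^sup>2) \<le> 2 * k * (2 / l) * \<omega> (t / sqrt c) + 2 * k * A"
      using main[OF True] by (simp add: distrib_left mult.assoc)
    also have "\<dots> \<le> D * \<omega> (t / sqrt c) + D"
      using D t c by (intro add_mono mult_right_mono weight_function_nonneg[OF wt]) auto
    finally show ?thesis by simp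
  next
    \<comment> \<open>For small \<open>t\<close> the competitor \<open>s = 1\<close> suffices, since
      \<open>\<omega> 1 = 0\<close> and \<open>t\<^sup>2 \<le> c \<le> D\<close>.\<close>
    case False
    then have "t \<le> sqrt c" using c by (simp add: field_simps)
    then have "t\<^sup>2 \<le> c" using t c power_mono[of t "sqrt c" 2] by simp
    moreover have "lower_conj (iota \<omega>) (t\<^sup>2) \<le> \<omega> 1 + t\<^sup>2"
      using lower_conj_le[OF wt, of "t\<^sup>2" 1] by simp
    moreover have "\<omega> 1 = 0" using wt by (simp add: weight_function_def)
    moreover have "0 \<le> D * \<omega> (1 / sqrt c * t)"
      using D t c by (intro mult_nonneg_nonneg weight_function_nonneg[OF wt]) auto
    ultimately show ?thesis using D by linarith
  qed
  have "1 / sqrt c > 0" using c by simp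
  then show ?thesis using D(1) bound by blast
qed

theorem theorem5p1:
  fixes \<omega> :: "real \<Rightarrow> real"
  assumes weight: "weight_function \<omega>"
    and log_o: "(\<lambda>t. ln t) \<in> o(\<omega>)"
    and convex: "convex_on UNIV (phi \<omega>)"
  defines "R \<equiv> \<forall>l>0. \<exists>k>0. \<exists>C>0. \<exists>h>0. \<forall>j. (w \<omega> l j)\<^sup>2 \<le> C * h ^ j * w \<omega> k j"
    and "B \<equiv> \<forall>l>0. \<exists>k>0. \<exists>C>0. \<exists>h>0. \<forall>j. (w \<omega> k j)\<^sup>2 \<le> C * h ^ j * w \<omega> l j"
    and "M \<equiv> \<exists>H>0. \<exists>C>0. \<forall>t\<ge>0. lower_conj (iota \<omega>) (t\<^sup>2) \<le> C * \<omega> (H * t) + C"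
  shows "(R \<longleftrightarrow> B) \<and> (B \<longleftrightarrow> M)"
proof -
  \<comment> \<open>A single pair of parameters gives (M), so (R) and (B) are each used only with
    the given parameter equal to 1.\<close>
  have M_if: M if "k > 0" "l > 0" "C > 0" "h > 0" "\<forall>j. (w \<omega> l j)\<^sup>2 \<le> C * h ^ j * w \<omega> k j" for k l C h
    unfolding M_def
    using lower_conj_le_if_w_square_le[OF weight log_o convex that(2,1,3,4)] that(5) by simp
  have M if R
  proof -
    obtain k C h where "k > 0" "C > 0" "h > 0" "\<forall>j. (w \<omega> 1 j)\<^sup>2 \<le> C * h ^ j * w \<omega> k j"
      using \<open>R\<close>[unfolded R_def, rule_format, of 1] by auto
    then show ?thesis by (intro M_if[of k 1 C h]) simp_all
  qed
  moreover have M if B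
  proof -
    obtain k C h where "k > 0" "C > 0" "h > 0" "\<forall>j. (w \<omega> k j)\<^sup>2 \<le> C * h ^ j * w \<omega> 1 j"
      using \<open>B\<close>[unfolded B_def, rule_format, of 1] by auto
    then show ?thesis by (intro M_if[of 1 k C h]) simp_all
  qed
  moreover have "R \<and> B" if M
  proof -
    obtain H C where H: "H > 0" and C: "C > 0"
      and M: "\<And>t. t \<ge> 0 \<Longrightarrow> lower_conj (iota \<omega>) (t\<^sup>2) \<le> C * \<omega> (H * t) + C"
      using \<open>M\<close> unfolding M_def by blast
    have *: "\<exists>D>0. \<exists>h>0. \<forall>j. (w \<omega> (2 * k / C) j)\<^sup>2 \<le> D * h ^ j * w \<omega> k j" if k: "k > 0" for k
    proof (intro exI conjI allI)
      show "(w \<omega> (2 * k / C) j)\<^sup>2 \<le> exp (C / k) * (H\<^sup>2 * k) ^ j * w \<omega> k j" for j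
        using M by (rule w_square_le_if_lower_conj_le[OF weight log_o H C k])
    qed (use H k in auto)
    have R
      unfolding R_def
    proof (intro allI impI)
      fix l :: real assume "l > 0"
      then show "\<exists>k>0. \<exists>D>0. \<exists>h>0. \<forall>j. (w \<omega> l j)\<^sup>2 \<le> D * h ^ j * w \<omega> k j"
        \<comment> \<open>Solves \<open>2 * k / C = l\<close> for \<open>k\<close>; for (B) the same
          relation is read in the other direction.\<close>
        using *[of "l * C / 2"] C by (intro exI[of _ "l * C / 2"]) auto
    qed
    moreover have B
      unfolding B_def
    proof (intro allI impI)
      fix l :: real assume "l > 0"
      then show "\<exists>k>0. \<exists>D>0. \<exists>h>0. \<forall>j. (w \<omega> k j)\<^sup>2 \<le> D * h ^ j * w \<omega> l j"
        using *[of l] C by (intro exI[of _ "2 * l / C"]) auto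
    qed
    ultimately show ?thesis ..
  qed
  ultimately show ?thesis by blast
qed

end
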